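(* Let $N$ be a timelike ruled surface of type $N_-$ in $\mathbb{R}_1^3$, $\vec r(s,v)=\vec c(s)+v\vec q(s)$, $s\in I$, with timelike striction curve $\vec c$, Frenet frame $\{\vec q,\vec h,\vec a\}$, curvatures $k_1,k_2$ and angle function $\theta$. Then the striction curve $\vec c$ is a line of curvature on $N$ if and only if $\tanh\theta=k_2/k_1$ holds on $I$.
   Context: $\mathbb{R}_1^3$ is Minkowski 3-space with metric $\langle\cdot,\cdot\rangle=-dx_1^2+dx_2^2+dx_3^2$. A nonzero vector $\vec v$ is timelike if $\langle\vec v,\vec v\rangle<0$, null if $\langle\vec v,\vec v\rangle=0$, spacelike if $\langle\vec v,\vec v\rangle>0$. Setting. All functions are smooth on an open interval $I$. A timelike ruled surface of type $N_-$ with timelike striction curve is $\vec r(s,v)=\vec c(s)+v\vec q(s)$, with ruling direction $\vec q$ unit timelike, where $\vec c$ is its striction curve, a timelike curve parametrized by arc length $s$. It has a Frenet frame $\{\vec q,\vec h,\vec a\}$ of mutually orthogonal vectors, $\langle\vec q,\vec q\rangle=-1$, $\langle\vec h,\vec h\rangle=\langle\vec a,\vec a\rangle=1$ ($\vec h$ is the central normal, i.e. the surface normal along $\vec c$; $\vec a$ the central tangent), with $\vec q\,'=k_1\vec h$, $\vec h'=k_1\vec q+k_2\vec a$, $\vec a'=-k_2\vec h$ (prime is $d/ds$) for functions $k_1,k_2$. Standing assumption: the derivatives of the frame vectors are non-null and $N$ is non-cylindrical; in particular $k_1\neq0$ and $k_1^2\neq k_2^2$ everywhere. The unit tangent of $\vec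 c$ is $\vec c\,'=\vec t=\cosh\theta\,\vec q+\sinh\theta\,\vec a$ for a real function $\theta$ (the hyperbolic angle between $\vec t$ and $\vec q$). The curve $\vec c$ is a line of curvature on $N$ if $\vec h'$ and $\vec t$ are linearly dependent on $I$, i.e. $\vec h'=\lambda\vec t$ for some scalar function $\lambda=\lambda(s)$. *)

theory Defs
  imports "HOL-Analysis.Analysis"
begin

text \<open>Minkowski 3-space is the vector space \<open>real ^ 3\<close> with the metric
  \<open>- dx1^2 + dx2^2 + dx3^2\<close>.  The norm of \<open>real ^ 3\<close> is used only for derivatives.\<close>

definition mink :: "real ^ 3 \<Rightarrow> real ^ 3 \<Rightarrow> real" where
  "mink u v = - (u $ 1 * v $ 1) + u $ 2 * v $ 2 + u $ 3 * v $ 3"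

definition timelike :: "real ^ 3 \<Rightarrow> bool" where
  "timelike v \<longleftrightarrow> v \<noteq> 0 \<and> mink v v < 0"

text \<open>The zero vector has no causal character; in particular it is not null.\<close>

definition null_vec :: "real ^ 3 \<Rightarrow> bool" where
  "null_vec v \<longleftrightarrow> v \<noteq> 0 \<and> mink v v = 0"

abbreviation vderiv :: "(real \<Rightarrow> 'a::real_normed_vector) \<Rightarrow> real \<Rightarrow> 'a" where
  "vderiv f \<equiv> \<lambda>s. vector_derivative f (at s)"

text \<open>Meaningful for open \<open>I\<close>, where all iterated derivatives are determined by \<open>f\<close> on \<open>I\<close>.\<close>

definition smooth_on :: "real set \<Rightarrow> (real \<Rightarrow> 'a::real_normed_vector) \<Rightarrow> bool" where
  "smooth_on I f \<longleftrightarrow> (\<forall>n. (vderiv ^^ n) f differentiable_on I)"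

definition ruled_surface ::
    "(real \<Rightarrow> real ^ 3) \<Rightarrow> (real \<Rightarrow> real ^ 3) \<Rightarrow> real \<Rightarrow> real \<Rightarrow> real ^ 3" where
  "ruled_surface c q s v = c s + v *\<^sub>R q s"

definition partial_s :: "(real \<Rightarrow> real \<Rightarrow> real ^ 3) \<Rightarrow> real \<Rightarrow> real \<Rightarrow> real ^ 3" where
  "partial_s r s v = vderiv (\<lambda>s. r s v) s"

definition partial_v :: "(real \<Rightarrow> real \<Rightarrow> real ^ 3) \<Rightarrow> real \<Rightarrow> real \<Rightarrow> real ^ 3" where
  "partial_v r s v = vderiv (\<lambda>v. r s v) v"

text \<open>The induced metric has Lorentzian signature, i.e. \<open>E G - F^2 < 0\<close>, at every regular
  point.  A ruled surface may be singular, for example along the striction curve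
  where the tangent of that curve is parallel to the ruling.\<close>

definition timelike_surface_on :: "real set \<Rightarrow> (real \<Rightarrow> real \<Rightarrow> real ^ 3) \<Rightarrow> bool" where
  "timelike_surface_on I r \<longleftrightarrow>
     (\<forall>s\<in>I. \<forall>v. dim {partial_s r s v, partial_v r s v} = 2 \<longrightarrow>
        mink (partial_s r s v) (partial_s r s v) * mink (partial_v r s v) (partial_v r s v)
          - (mink (partial_s r s v) (partial_v r s v))\<^sup>2 < 0)"

definition striction_curve_on ::
    "real set \<Rightarrow> (real \<Rightarrow> real ^ 3) \<Rightarrow> (real \<Rightarrow> real ^ 3) \<Rightarrow> bool" where
  "striction_curve_on I c q \<longleftrightarrow> (\<forall>s\<in>I. mink (vderiv c s) (vderiv q s) = 0)"

text \<open>\<open>n\<close> is normal to \<open>r\<close> along its base curve \<open>v = 0\<close>.\<close>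

definition normal_along_base_on ::
    "real set \<Rightarrow> (real \<Rightarrow> real \<Rightarrow> real ^ 3) \<Rightarrow> (real \<Rightarrow> real ^ 3) \<Rightarrow> bool" where
  "normal_along_base_on I r n \<longleftrightarrow>
     (\<forall>s\<in>I. mink (n s) (partial_s r s 0) = 0 \<and> mink (n s) (partial_v r s 0) = 0)"

text \<open>Timelike ruled surface of type \<open>N_-\<close> (timelike rulings) whose striction curve
  \<open>c\<close> is timelike and parametrized by arc length, with its Frenet frame \<open>q, h, a\<close>,
  curvatures \<open>k1, k2\<close> and hyperbolic angle \<open>\<theta>\<close> between \<open>c'\<close> and \<open>q\<close>.  The data are only
  constrained on \<open>I\<close>.  Some conditions (e.g. \<open>striction_curve\<close> and \<open>timelike_surface\<close>)
  follow from the Frenet equations and the formula for \<open>c'\<close>.\<close>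

locale timelike_ruled_surface_N_minus =
  fixes I :: "real set"
    and c q h a :: "real \<Rightarrow> real ^ 3"
    and k1 k2 \<theta> :: "real \<Rightarrow> real"
  assumes interval: "open I" "is_interval I" "I \<noteq> {}"
    and smooth: "smooth_on I c" "smooth_on I q" "smooth_on I h" "smooth_on I a"
      "smooth_on I k1" "smooth_on I k2" "smooth_on I \<theta>"
    and timelike_surface: "timelike_surface_on I (ruled_surface c q)"
    and striction_curve: "striction_curve_on I c q"
    and timelike_curve: "\<And>s. s \<in> I \<Longrightarrow> timelike (vderiv c s)"
    and arc_length: "\<And>s. s \<in> I \<Longrightarrow> mink (vderiv c s) (vderiv c s) = -1"
    and timelike_ruling: "\<And>s. s \<in> I \<Longrightarrow> timelike (q s)"
    and frame_norm: "\<And>s. s \<in> I \<Longrightarrow> mink (q s) (q s) = -1"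
      "\<And>s. s \<in> I \<Longrightarrow> mink (h s) (h s) = 1"
      "\<And>s. s \<in> I \<Longrightarrow> mink (a s) (a s) = 1"
    and frame_orth: "\<And>s. s \<in> I \<Longrightarrow> mink (q s) (h s) = 0"
      "\<And>s. s \<in> I \<Longrightarrow> mink (q s) (a s) = 0"
      "\<And>s. s \<in> I \<Longrightarrow> mink (h s) (a s) = 0"
    and central_normal: "normal_along_base_on I (ruled_surface c q) h"
    and frenet: "\<And>s. s \<in> I \<Longrightarrow> vderiv q s = k1 s *\<^sub>R h s"
      "\<And>s. s \<in> I \<Longrightarrow> vderiv h s = k1 s *\<^sub>R q s + k2 s *\<^sub>R a s"
      "\<And>s. s \<in> I \<Longrightarrow> vderiv a s = - k2 s *\<^sub>R h s"
    and non_null: "\<And>s. s \<in> I \<Longrightarrow> \<not> null_vec (vderiv q s)"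
      "\<And>s. s \<in> I \<Longrightarrow> \<not> null_vec (vderiv h s)"
      "\<And>s. s \<in> I \<Longrightarrow> \<not> null_vec (vderiv a s)"
    and non_cylindrical: "\<And>s. s \<in> I \<Longrightarrow> vderiv q s \<noteq> 0"
    and tangent: "\<And>s. s \<in> I \<Longrightarrow> vderiv c s = cosh (\<theta> s) *\<^sub>R q s + sinh (\<theta> s) *\<^sub>R a s"

text \<open>\<open>c\<close> is a line of curvature of a surface with unit normal \<open>n\<close> along \<open>c\<close>
  (Rodrigues' criterion).\<close>

definition line_of_curvature_on ::
    "real set \<Rightarrow> (real \<Rightarrow> real ^ 3) \<Rightarrow> (real \<Rightarrow> real ^ 3) \<Rightarrow> bool" where
  "line_of_curvature_on I n c \<longleftrightarrow>
     (\<exists>l :: real \<Rightarrow> real. \<forall>s\<in>I. vderiv n s = l s *\<^sub>R vderiv c s)"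

end

theory Submission
  imports Defs
begin

text \<open>Both \<open>h'\<close> and \<open>c'\<close> lie in the plane spanned by the orthonormal
  pair \<open>q\<close>, \<open>a\<close>, with coefficients (\<open>k1\<close>, \<open>k2\<close>)
  and (cosh \<theta>, sinh \<theta>). So at each point \<open>h'\<close> is a multiple of
  \<open>c'\<close> iff these coefficient pairs are proportional
  (\<open>mink_orthonormal_combination_eq_iff\<close>). As \<open>k1\<close> never vanishes,
  eliminating the factor leaves the ratio condition
  (\<open>exists_cosh_sinh_multiple_iff\<close>).\<close>

lemma mink_add_left: "mink (u + v) w = mink u w + mink v w"
  by (simp add: mink_def algebra_simps)

lemma mink_scaleR_left: "mink (x *\<^sub>R u) v = x * mink u v"
  by (simp add: mink_def algebra_simps)

lemma mink_commute: "mink u v = mink v u"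
  by (simp add: mink_def mult.commute)

text \<open>Pairing with \<open>q\<close> and with \<open>a\<close> recovers the two coefficients,
  the first up to sign because \<open>q\<close> is timelike.\<close>

lemma mink_orthonormal_combination_eq_iff:
  assumes "mink q q = -1" "mink a a = 1" "mink q a = 0"
  shows "x *\<^sub>R q + y *\<^sub>R a = x' *\<^sub>R q + y' *\<^sub>R a \<longleftrightarrow> x = x' \<and> y = y'"
proof
  assume eq: "x *\<^sub>R q + y *\<^sub>R a = x' *\<^sub>R q + y' *\<^sub>R a"
  have "mink (x *\<^sub>R q + y *\<^sub>R a) w = mink (x' *\<^sub>R q + y' *\<^sub>R a) w" for w
    by (simp only: eq)
  from this[of q] this[of a] show "x = x' \<and> y = y'"
    using assms by (simp add: mink_add_left mink_scaleR_left mink_commute[of a q])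
qed simp

text \<open>As cosh is positive, the first equation forces \<open>l = x / cosh t\<close>; this is
  nonzero, so \<open>l\<close> cancels in \<open>y / x\<close>.\<close>

lemma exists_cosh_sinh_multiple_iff:
  fixes x y t :: real
  assumes "x \<noteq> 0"
  shows "(\<exists>l. x = l * cosh t \<and> y = l * sinh t) \<longleftrightarrow> tanh t = y / x"
proof
  assume "tanh t = y / x"
  then have "x = x / cosh t * cosh t \<and> y = x / cosh t * sinh t"
    using assms by (simp add: tanh_def field_simps)
  then show "\<exists>l. x = l * cosh t \<and> y = l * sinh t" ..
qed (use assms in \<open>auto simp: tanh_def\<close>)

theorem theorem3p3:
  fixes I :: "real set"
    and c q h a :: "real \<Rightarrow> real ^ 3"
    and k1 k2 \<theta> :: "real \<Rightarrow> real"
  assumes "timelike_ruled_surface_N_minus I c q h a k1 k2 \<theta>"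
  shows "line_of_curvature_on I h c \<longleftrightarrow> (\<forall>s\<in>I. tanh (\<theta> s) = k2 s / k1 s)"
proof -
  interpret timelike_ruled_surface_N_minus I c q h a k1 k2 \<theta>
    by (fact assms)
  have "(\<exists>l. vderiv h s = l *\<^sub>R vderiv c s) \<longleftrightarrow> tanh (\<theta> s) = k2 s / k1 s"
    if s: "s \<in> I" for s
  proof -
    \<comment> \<open>At a zero of \<open>k1\<close> the derivative of \<open>q\<close> would
      vanish, contrary to non-cylindricity.\<close>
    have "k1 s \<noteq> 0"
      using non_cylindrical[OF s] frenet(1)[OF s] by auto
    moreover have "vderiv h s = l *\<^sub>R vderiv c s \<longleftrightarrow>
        k1 s = l * cosh (\<theta> s) \<and> k2 s = l * sinh (\<theta> s)" for l
      using mink_orthonormal_combination_eq_iff[OF frame_norm(1,3)[OF s] frame_orth(2)[OF s]]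
      by (simp add: frenet(2)[OF s] tangent[OF s] scaleR_add_right)
    ultimately show ?thesis
      by (simp add: exists_cosh_sinh_multiple_iff)
  qed
  then show ?thesis
    \<comment> \<open>The factor may be any function of \<open>s\<close>, with no regularity
      required, so factors chosen point by point suffice.\<close>
    unfolding line_of_curvature_on_def bchoice_iff[symmetric]
    by (metis (no_types, lifting))
qed

end
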